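(* For each $n$ and $p=p(n)\in[0,1]$, let $\mathcal{A}\subseteq S_{n+1}$ be the random set obtained by picking each $\rho\in S_{n+1}$ independently with probability $p$. There exist real-valued functions $\varepsilon^*(n)\to0$ and $\varepsilon(n)\to0$ (as $n\to\infty$) such that, for every sequence $p=p(n)\in[0,1]$: (1) if $p\le\frac{\log n}{n}(1+\varepsilon^*(n))$ for all sufficiently large $n$, then $\mathbb{P}(\mathcal{A}\text{ is a cover of }S_n)\to0$ as $n\to\infty$; (2) if $p\ge\frac{\log n}{n}(1+\varepsilon(n))$ for all sufficiently large $n$, then $\mathbb{P}(\mathcal{A}\text{ is a cover of }S_n)\to1$ as $n\to\infty$.
   Context: $S_n$ is the set of all permutations of $[n]=\{1,2,\ldots,n\}$, written as words. A permutation $\rho\in S_{n+1}$ covers $\pi\in S_n$ if $\rho$ has a (not necessarily contiguous) subsequence of length $n$ that is order-isomorphic to $\pi$. A set $\mathcal{A}\subseteq S_{n+1}$ is a cover of $S_n$ if every $\pi\in S_n$ is covered by at least one element of $\mathcal{A}$. $\log$ is the natural logarithm. *)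

theory Defs
  imports
    "HOL-Probability.Probability"
    "HOL-Library.Sublist"
    "HOL-Combinatorics.Multiset_Permutations"
begin

abbreviation perms :: "nat \<Rightarrow> nat list set" where
  "perms n \<equiv> permutations_of_set {1..n}"

definition order_isomorphic :: "nat list \<Rightarrow> nat list \<Rightarrow> bool" where
  "order_isomorphic xs ys \<longleftrightarrow>
     length xs = length ys \<and>
     (\<forall>i < length xs. \<forall>j < length xs. xs ! i < xs ! j \<longleftrightarrow> ys ! i < ys ! j)"

(* Order isomorphism preserves length, so for \<rho> in S_(n+1) and \<pi> in S_n
   the subsequence below automatically has length n. *)
definition perm_covers :: "nat list \<Rightarrow> nat list \<Rightarrow> bool" where
  "perm_covers \<rho> \<pi> \<longleftrightarrow> (\<exists>\<sigma>. subseq \<sigma> \<rho> \<and> order_isomorphic \<sigma> \<pi>)"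

definition is_cover :: "nat \<Rightarrow> nat list set \<Rightarrow> bool" where
  "is_cover n \<A> \<longleftrightarrow> \<A> \<subseteq> perms (n + 1) \<and> (\<forall>\<pi> \<in> perms n. \<exists>\<rho> \<in> \<A>. perm_covers \<rho> \<pi>)"

definition random_subset :: "'a set \<Rightarrow> real \<Rightarrow> 'a set pmf" where
  "random_subset S p =
     map_pmf (\<lambda>f. {x \<in> S. f x}) (Pi_pmf S False (\<lambda>_. bernoulli_pmf p))"

definition cover_prob :: "nat \<Rightarrow> real \<Rightarrow> real" where
  "cover_prob n p =
     measure_pmf.prob (random_subset (perms (n + 1)) p) {\<A>. is_cover n \<A>}"

end

theory Submission
  imports Defs "HOL-Real_Asymp.Real_Asymp"
begin

text \<open>Every \<open>\<pi> \<in> S\<^sub>n\<close> is covered by at least \<open>n (n - 1)\<close> and at most \<open>(n + 1)\<^sup>2\<close> permutations,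
  namely its one-point insertions. Hence for \<open>p \<ge> (ln n + 2) / n\<close> the expected number of
  uncovered \<open>\<pi>\<close> is at most \<open>n! exp (- p n (n - 1)) \<rightarrow> 0\<close>.
  For the other direction no second moment is needed: each \<open>\<pi>\<close> shares a cover with at most
  \<open>(n + 1)\<^sup>3\<close> permutations, so a greedy choice gives at least \<open>n! / (n + 1)\<^sup>3\<close> permutations with
  pairwise disjoint sets of covers. These are covered independently of each other, and for
  \<open>p \<le> (ln n - 2) / n\<close> with high probability one of them is missed, because
  \<open>n! (1 - p) ^ (n + 1)\<^sup>2\<close> grows faster than any polynomial.\<close>

section \<open>Random subsets and the probability of hitting given sets\<close>

text \<open>Cutting both sides down to the supports makes them countable, as the product formula
  used here requires.\<close>

lemma prob_pair_pmf_Times: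
  "measure_pmf.prob (pair_pmf M N) (A \<times> B) = measure_pmf.prob M A * measure_pmf.prob N B"
proof -
  have "measure_pmf.prob (pair_pmf M N) (A \<times> B) =
          measure_pmf.prob (pair_pmf M N) ((A \<inter> set_pmf M) \<times> (B \<inter> set_pmf N))"
    by (subst measure_Int_set_pmf [symmetric]) (simp add: Times_Int_Times)
  also have "\<dots> = measure_pmf.prob M (A \<inter> set_pmf M) * measure_pmf.prob N (B \<inter> set_pmf N)"
    by (rule measure_pmf_prob_product) auto
  finally show ?thesis by (simp add: measure_Int_set_pmf)
qed

lemma set_random_subset: "A \<in> set_pmf (random_subset S p) \<Longrightarrow> A \<subseteq> S"
  by (auto simp: random_subset_def)

text \<open>The coins on \<open>S\<close> and on \<open>T\<close> are tossed independently. In this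
  form independence enters the induction over a disjoint family.\<close>

lemma random_subset_Un:
  assumes "finite S" "finite T" "S \<inter> T = {}"
  shows "random_subset (S \<union> T) p =
    map_pmf (\<lambda>(A, B). A \<union> B) (pair_pmf (random_subset S p) (random_subset T p))"
proof -
  have "pair_pmf (random_subset S p) (random_subset T p) =
      map_pmf (\<lambda>(f, g). ({x \<in> S. f x}, {x \<in> T. g x}))
        (pair_pmf (Pi_pmf S False (\<lambda>_. bernoulli_pmf p)) (Pi_pmf T False (\<lambda>_. bernoulli_pmf p)))"
    by (simp add: random_subset_def map_pair)
  then show ?thesis
    unfolding random_subset_def [of "S \<union> T"] Pi_pmf_union [OF assms]
    using assms(3) by (auto simp: map_pmf_comp case_prod_unfold intro!: map_pmf_cong)
qed

lemma prob_random_subset_empty: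
  assumes "finite S" "0 \<le> p" "p \<le> 1"
  shows "measure_pmf.prob (random_subset S p) {{}} = (1 - p) ^ card S"
proof -
  have "measure_pmf.prob (random_subset S p) {{}} =
      measure_pmf.prob (Pi_pmf S False (\<lambda>_. bernoulli_pmf p)) (Pi S (\<lambda>_. {False}))"
    unfolding random_subset_def measure_map_pmf
    by (intro arg_cong [where f = "measure_pmf.prob _"]) auto
  also have "\<dots> = (\<Prod>x\<in>S. measure_pmf.prob (bernoulli_pmf p) {False})"
    by (rule measure_Pi_pmf_Pi) fact
  also have "\<dots> = (1 - p) ^ card S"
    using assms by (simp add: measure_pmf_single)
  finally show ?thesis .
qed

lemma prob_random_subset_nonempty:
  assumes "finite S" "0 \<le> p" "p \<le> 1"
  shows "measure_pmf.prob (random_subset S p) {A. A \<noteq> {}} = 1 - (1 - p) ^ card S"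
proof -
  have "measure_pmf.prob (random_subset S p) (- {{}}) = 1 - measure_pmf.prob (random_subset S p) {{}}"
    using measure_pmf.prob_compl [of "{{}}" "random_subset S p"] by (simp add: Compl_eq_Diff_UNIV)
  moreover have "- {{}} = {A :: 'a set. A \<noteq> {}}"
    by auto
  ultimately show ?thesis
    using prob_random_subset_empty [OF assms] by simp
qed

text \<open>One set \<open>C i\<close> is split off at a time. By disjointness the others lie in
  \<open>S - C i\<close>, where the random set is independent of its part in \<open>C i\<close>. The
  ground set shrinks, so the induction leaves \<open>S\<close> arbitrary.\<close>

lemma prob_random_subset_hits:
  assumes "finite F" "finite S" "0 \<le> p" "p \<le> 1"
    and "\<And>i. i \<in> F \<Longrightarrow> C i \<subseteq> S" and "disjoint_family_on C F"
  shows "measure_pmf.prob (random_subset S p) {A. \<forall>i\<in>F. A \<inter> C i \<noteq> {}} =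
           (\<Prod>i\<in>F. 1 - (1 - p) ^ card (C i))"
  using assms(1,2,5,6)
proof (induction F arbitrary: S rule: finite_induct)
  case empty
  then show ?case by simp
next
  case (insert i F)
  define T where "T = S - C i"
  have CT: "C j \<subseteq> T" if "j \<in> F" for j
    using insert.prems insert.hyps that unfolding T_def disjoint_family_on_def
    by (metis Diff_disjoint Diff_mono Diff_triv Int_commute insertI1 insertI2 subset_refl)
  have fin: "finite (C i)" "finite T"
    using insert.prems by (auto simp: T_def intro: finite_subset)
  have S: "S = C i \<union> T"
    using insert.prems by (auto simp: T_def)
  have "measure_pmf.prob (random_subset S p) {A. \<forall>j\<in>insert i F. A \<inter> C j \<noteq> {}} =
      measure_pmf.prob (pair_pmf (random_subset (C i) p) (random_subset T p))
        {(X, Y). \<forall>j\<in>insert i F. (X \<union> Y) \<inter> C j \<noteq> {}}"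
    unfolding S by (subst random_subset_Un) (use fin in \<open>auto simp: T_def vimage_def case_prod_unfold\<close>)
  also have "\<dots> = measure_pmf.prob (pair_pmf (random_subset (C i) p) (random_subset T p))
        ({X. X \<noteq> {}} \<times> {Y. \<forall>j\<in>F. Y \<inter> C j \<noteq> {}})"
  \<comment> \<open>The events agree on pairs with \<open>X \<subseteq> C i\<close> and
    \<open>Y \<subseteq> T\<close>; all other pairs have mass zero.\<close>
  proof (rule measure_prob_cong_0)
    have *: "(\<forall>j\<in>insert i F. (X \<union> Y) \<inter> C j \<noteq> {}) \<longleftrightarrow> X \<noteq> {} \<and> (\<forall>j\<in>F. Y \<inter> C j \<noteq> {})"
      if "X \<subseteq> C i" "Y \<subseteq> T" for X Y
    proof -
      have "(X \<union> Y) \<inter> C i = X"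
        using that by (auto simp: T_def)
      moreover have "(X \<union> Y) \<inter> C j = Y \<inter> C j" if "j \<in> F" for j
        using CT [OF that] \<open>X \<subseteq> C i\<close> by (auto simp: T_def)
      ultimately show ?thesis by simp
    qed
    show "pmf (pair_pmf (random_subset (C i) p) (random_subset T p)) x = 0"
      if "x \<in> {(X, Y). \<forall>j\<in>insert i F. (X \<union> Y) \<inter> C j \<noteq> {}} -
        {X. X \<noteq> {}} \<times> {Y. \<forall>j\<in>F. Y \<inter> C j \<noteq> {}}" for x
      using that * [of "fst x" "snd x"] set_random_subset
      by (fastforce simp: pmf_eq_0_set_pmf)
    show "pmf (pair_pmf (random_subset (C i) p) (random_subset T p)) x = 0"
      if "x \<in> {X. X \<noteq> {}} \<times> {Y. \<forall>j\<in>F. Y \<inter> C j \<noteq> {}} -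
        {(X, Y). \<forall>j\<in>insert i F. (X \<union> Y) \<inter> C j \<noteq> {}}" for x
      using that * [of "fst x" "snd x"] set_random_subset
      by (fastforce simp: pmf_eq_0_set_pmf)
  qed
  also have "\<dots> = (1 - (1 - p) ^ card (C i)) * (\<Prod>j\<in>F. 1 - (1 - p) ^ card (C j))"
    using insert.IH [OF fin(2) CT] insert.prems(3) fin assms(3,4)
    by (simp add: prob_pair_pmf_Times prob_random_subset_nonempty disjoint_family_on_def)
  also have "\<dots> = (\<Prod>j\<in>insert i F. 1 - (1 - p) ^ card (C j))"
    using insert.hyps by simp
  finally show ?case .
qed

text \<open>Union bound over the events that \<open>C i\<close> is missed. The probability of one
  such event comes from the exact formula for the singleton family.\<close>

lemma prob_random_subset_hits_ge:
  assumes "finite F" "finite S" "0 \<le> p" "p \<le> 1" and "\<And>i. i \<in> F \<Longrightarrow> C i \<subseteq> S"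
  shows "measure_pmf.prob (random_subset S p) {A. \<forall>i\<in>F. A \<inter> C i \<noteq> {}} \<ge>
           1 - (\<Sum>i\<in>F. (1 - p) ^ card (C i))"
proof -
  let ?P = "measure_pmf.prob (random_subset S p)"
  have miss: "?P {A. A \<inter> C i = {}} = (1 - p) ^ card (C i)" if "i \<in> F" for i
  proof -
    have "?P {A. \<forall>j\<in>{i}. A \<inter> C j \<noteq> {}} = (\<Prod>j\<in>{i}. 1 - (1 - p) ^ card (C j))"
      using assms that by (intro prob_random_subset_hits) (auto simp: disjoint_family_on_def)
    moreover have "?P (- {A. A \<inter> C i = {}}) = 1 - ?P {A. A \<inter> C i = {}}"
      using measure_pmf.prob_compl [of "{A. A \<inter> C i = {}}" "random_subset S p"]
      by (simp add: Compl_eq_Diff_UNIV)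
    ultimately show ?thesis
      by (simp add: Collect_neg_eq)
  qed
  have "?P (\<Union>i\<in>F. {A. A \<inter> C i = {}}) \<le> (\<Sum>i\<in>F. ?P {A. A \<inter> C i = {}})"
    using assms by (intro measure_pmf.finite_measure_subadditive_finite) auto
  also have "\<dots> = (\<Sum>i\<in>F. (1 - p) ^ card (C i))"
    by (intro sum.cong miss refl)
  finally have "?P (\<Union>i\<in>F. {A. A \<inter> C i = {}}) \<le> \<dots>" .
  moreover have "?P (- (\<Union>i\<in>F. {A. A \<inter> C i = {}})) = 1 - ?P (\<Union>i\<in>F. {A. A \<inter> C i = {}})"
    using measure_pmf.prob_compl [of "\<Union>i\<in>F. {A. A \<inter> C i = {}}" "random_subset S p"]
    by (simp add: Compl_eq_Diff_UNIV)
  moreover have "- (\<Union>i\<in>F. {A. A \<inter> C i = {}}) = {A. \<forall>i\<in>F. A \<inter> C i \<noteq> {}}"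
    by auto
  ultimately show ?thesis by simp
qed

section \<open>Large disjoint subfamilies\<close>

text \<open>A maximal disjoint subfamily meets every member of the family.\<close>

lemma large_disjoint_subfamily:
  assumes "finite V" and "\<And>x. x \<in> V \<Longrightarrow> C x \<noteq> {}"
    and "\<And>x. x \<in> V \<Longrightarrow> card {y \<in> V. C x \<inter> C y \<noteq> {}} \<le> D"
  obtains F where "F \<subseteq> V" "disjoint_family_on C F" "card V \<le> card F * D"
proof -
  let ?P = "\<lambda>F. F \<subseteq> V \<and> disjoint_family_on C F"
  have "?P {}" by (simp add: disjoint_family_on_def)
  moreover have "\<forall>F. ?P F \<longrightarrow> card F \<le> card V"
    using assms(1) by (simp add: card_mono)
  ultimately obtain F where F: "?P F" and max: "\<And>G. ?P G \<Longrightarrow> card G \<le> card F"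
    using ex_has_greatest_nat [of ?P "{}" card "Suc (card V)"] by (auto simp: less_Suc_eq_le)
  have fin: "finite F" using F assms(1) finite_subset by blast
  have "V \<subseteq> (\<Union>x\<in>F. {y \<in> V. C x \<inter> C y \<noteq> {}})"
  proof (rule ccontr)
    assume "\<not> ?thesis"
    then obtain y where y: "y \<in> V" "\<And>x. x \<in> F \<Longrightarrow> C x \<inter> C y = {}" by blast
    \<comment> \<open>Since \<open>C y\<close> is nonempty, \<open>y \<in> F\<close> would
      contradict \<open>C y \<inter> C y = {}\<close>. Hence inserting \<open>y\<close> increases
      the cardinality.\<close>
    have "y \<notin> F" using y assms(2) by blast
    moreover have "?P (insert y F)"
      using F y by (auto simp: disjoint_family_on_def)
    ultimately show False using max [of "insert y F"] fin by simp
  qed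
  then have "card V \<le> card (\<Union>x\<in>F. {y \<in> V. C x \<inter> C y \<noteq> {}})"
    using assms(1) fin by (intro card_mono) auto
  also have "\<dots> \<le> (\<Sum>x\<in>F. card {y \<in> V. C x \<inter> C y \<noteq> {}})"
    by (rule card_UN_le) fact
  also have "\<dots> \<le> card F * D"
    using sum_bounded_above [of F "\<lambda>x. card {y \<in> V. C x \<inter> C y \<noteq> {}}" D] assms(3) F by auto
  finally show ?thesis using that F by blast
qed

section \<open>Order isomorphism and deletion of one letter\<close>

lemma rank_inj:
  fixes A :: "nat set"
  assumes "finite A" "a \<in> A" "b \<in> A" "card {x \<in> A. x < a} = card {x \<in> A. x < b}"
  shows "a = b"
proof -
  have less: "card {x \<in> A. x < a} < card {x \<in> A. x < b}" if "a < b" "a \<in> A" for a b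
    using assms(1) that by (intro psubset_card_mono) auto
  show ?thesis
    using less [of a b] less [of b a] assms(2-4) by (cases a b rule: linorder_cases) simp_all
qed

text \<open>The number of entries below the \<open>i\<close>-th one can be read off the order
  pattern, and within a fixed set of entries this rank determines the entry.\<close>

lemma order_isomorphic_unique:
  assumes "order_isomorphic xs ys" "set xs = set ys" "distinct xs" "distinct ys"
  shows "xs = ys"
proof (rule nth_equalityI)
  show len: "length xs = length ys" using assms by (simp add: order_isomorphic_def)
  fix i assume i: "i < length xs"
  have rank: "card {x \<in> set zs. x < zs ! i} = card {j. j < length zs \<and> zs ! j < zs ! i}"
    if "distinct zs" for zs :: "nat list"
  proof -
    have "{x \<in> set zs. x < zs ! i} = (!) zs ` {j. j < length zs \<and> zs ! j < zs ! i}"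
      by (auto simp: in_set_conv_nth)
    moreover have "inj_on ((!) zs) {j. j < length zs \<and> zs ! j < zs ! i}"
      using that by (auto intro!: inj_onI simp: nth_eq_iff_index_eq)
    ultimately show ?thesis by (simp add: card_image)
  qed
  have "{j. j < length xs \<and> xs ! j < xs ! i} = {j. j < length ys \<and> ys ! j < ys ! i}"
    using assms(1) i by (auto simp: order_isomorphic_def)
  then have "card {x \<in> set xs. x < xs ! i} = card {x \<in> set xs. x < ys ! i}"
    using rank [OF assms(3)] rank [OF assms(4)] assms(2) by simp
  then show "xs ! i = ys ! i"
    using rank_inj [of "set xs" "xs ! i" "ys ! i"] nth_mem [of i xs] nth_mem [of i ys] i len assms(2)
    by simp
qed

lemma order_isomorphic_sym: "order_isomorphic xs ys \<Longrightarrow> order_isomorphic ys xs"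
  by (auto simp: order_isomorphic_def)

lemma order_isomorphic_trans:
  "order_isomorphic xs ys \<Longrightarrow> order_isomorphic ys zs \<Longrightarrow> order_isomorphic xs zs"
  by (auto simp: order_isomorphic_def)

text \<open>The lengths allow a single skipped letter. Once it is skipped the remaining words have
  equal length, so they coincide.\<close>

lemma subseq_remove_nth:
  assumes "subseq xs ys" "length ys = Suc (length xs)"
  shows "\<exists>i<length ys. xs = take i ys @ drop (Suc i) ys"
  using assms
proof (induction rule: list_emb.induct)
  case (list_emb_Nil ys)
  then show ?case by (auto simp: length_Suc_conv)
next
  case (list_emb_Cons xs ys y)
  then have "xs = ys" by (simp add: subseq_same_length)
  then show ?case by (intro exI [of _ 0]) simp
next
  case (list_emb_Cons2 x y xs ys)
  then have "\<exists>i<length ys. xs = take i ys @ drop (Suc i) ys" by simp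
  then obtain i where i: "i < length ys" "xs = take i ys @ drop (Suc i) ys" by blast
  have "x # xs = take (Suc i) (y # ys) @ drop (Suc (Suc i)) (y # ys)"
    unfolding take_Suc_Cons drop_Suc_Cons append_Cons i(2) [symmetric] using list_emb_Cons2 by simp
  then show ?case using i(1) by (intro exI [of _ "Suc i"]) simp
qed

section \<open>One-point insertions\<close>

text \<open>The increasing bijection from the naturals onto the naturals other than
  \<open>v\<close>; it frees the value \<open>v\<close> for insertion.\<close>

definition bump :: "nat \<Rightarrow> nat \<Rightarrow> nat" where
  "bump v x = (if x < v then x else Suc x)"

text \<open>Positions count from 0, so \<open>i = length \<pi>\<close> appends \<open>v\<close> at
  the end.\<close>

definition ins :: "nat list \<Rightarrow> nat \<Rightarrow> nat \<Rightarrow> nat list" where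
  "ins \<pi> i v = take i (map (bump v) \<pi>) @ v # drop i (map (bump v) \<pi>)"

lemma bump_less_iff [simp]: "bump v x < bump v y \<longleftrightarrow> x < y"
  by (auto simp: bump_def)

lemma bump_eq_iff [simp]: "bump v x = bump v y \<longleftrightarrow> x = y"
  by (auto simp: bump_def)

lemma order_isomorphic_map_bump: "order_isomorphic (map (bump v) \<pi>) \<pi>"
  by (simp add: order_isomorphic_def)

lemma permutations_of_set_iff: "xs \<in> permutations_of_set A \<longleftrightarrow> distinct xs \<and> set xs = A"
  by (auto simp: permutations_of_set_def)

lemma length_perms: "\<pi> \<in> perms n \<Longrightarrow> length \<pi> = n"
  using distinct_card [of \<pi>] by (simp add: permutations_of_set_iff)

lemma set_map_bump:
  assumes "set \<pi> = {1..n}" "v \<in> {1..n + 1}"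
  shows "set (map (bump v) \<pi>) = {1..n + 1} - {v}"
proof -
  have "x \<in> bump v ` {1..n}" if "x \<in> {1..n + 1} - {v}" for x
  proof (cases "x < v")
    case True
    then show ?thesis using that assms by (intro image_eqI [of _ _ x]) (auto simp: bump_def)
  next
    case False
    then show ?thesis using that assms by (intro image_eqI [of _ _ "x - 1"]) (auto simp: bump_def)
  qed
  moreover have "bump v ` {1..n} \<subseteq> {1..n + 1} - {v}"
    by (auto simp: bump_def)
  ultimately have "bump v ` {1..n} = {1..n + 1} - {v}"
    by blast
  then show ?thesis using assms(1) by simp
qed

lemma ins_in_perms:
  assumes "\<pi> \<in> perms n" "v \<in> {1..n + 1}"
  shows "ins \<pi> i v \<in> perms (n + 1)"
proof -
  define \<sigma> where "\<sigma> = map (bump v) \<pi>"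
  have s: "set \<sigma> = {1..n + 1} - {v}" "distinct \<sigma>"
    using assms set_map_bump [of \<pi> n v] by (simp_all add: \<sigma>_def permutations_of_set_iff distinct_map inj_on_def)
  \<comment> \<open>Up to order the word is \<open>v # \<sigma>\<close>; the multiset yields both
    its entries and its distinctness.\<close>
  have "mset (ins \<pi> i v) = mset (v # \<sigma>)"
    unfolding ins_def \<sigma>_def [symmetric]
    by (metis append_take_drop_id mset.simps(2) mset_append union_mset_add_mset_right)
  then have "set (ins \<pi> i v) = set (v # \<sigma>)" "distinct (ins \<pi> i v) = distinct (v # \<sigma>)"
    by (metis set_mset_mset, metis mset_eq_imp_distinct_iff)
  then show ?thesis using s assms(2) by (auto simp: permutations_of_set_iff)
qed

lemma perm_covers_ins: "perm_covers (ins \<pi> i v) \<pi>"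
proof -
  have "subseq (take i (map (bump v) \<pi>) @ drop i (map (bump v) \<pi>)) (ins \<pi> i v)"
    unfolding ins_def by (intro list_emb_append_mono) auto
  then show ?thesis
    unfolding perm_covers_def using order_isomorphic_map_bump by (metis append_take_drop_id)
qed

section \<open>Counting covers\<close>

text \<open>These sets turn the cover property into a hitting problem: a set of permutations in
  \<open>perms (n + 1)\<close> is a cover iff it meets each of them.\<close>

definition covers :: "nat \<Rightarrow> nat list \<Rightarrow> nat list set" where
  "covers n \<pi> = {\<rho> \<in> perms (n + 1). perm_covers \<rho> \<pi>}"

text \<open>Deleting a suitable letter \<open>v\<close> from \<open>\<rho>\<close> leaves the
  pattern of \<open>\<pi>\<close> on the entries other than \<open>v\<close>. Only
  \<open>map (bump v) \<pi>\<close> has this pattern and these entries, so reinserting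
  \<open>v\<close> restores \<open>\<rho>\<close>.\<close>

lemma covers_subset_ins:
  assumes "\<pi> \<in> perms n"
  shows "covers n \<pi> \<subseteq> (\<lambda>(i, v). ins \<pi> i v) ` ({..n} \<times> {1..n + 1})"
proof
  fix \<rho> assume "\<rho> \<in> covers n \<pi>"
  then obtain \<sigma> where \<rho>: "\<rho> \<in> perms (n + 1)" and \<sigma>: "subseq \<sigma> \<rho>" "order_isomorphic \<sigma> \<pi>"
    by (auto simp: covers_def perm_covers_def)
  have len: "length \<rho> = n + 1" "length \<sigma> = n" "length \<pi> = n"
    using length_perms \<rho> assms \<sigma>(2) by (auto simp: order_isomorphic_def)
  obtain i where i: "i \<le> n" "\<sigma> = take i \<rho> @ drop (Suc i) \<rho>"
    using subseq_remove_nth [OF \<sigma>(1)] len by (metis Suc_eq_plus1 less_Suc_eq_le)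
  define v where "v = \<rho> ! i"
  have split: "\<rho> = take i \<rho> @ v # drop (Suc i) \<rho>"
    using i len unfolding v_def by (simp add: id_take_nth_drop)
  have v: "v \<in> {1..n + 1}"
    using \<rho> i len unfolding permutations_of_set_iff v_def by (metis le_imp_less_Suc nth_mem Suc_eq_plus1)
  have "distinct (v # \<sigma>) \<and> set (v # \<sigma>) = {1..n + 1}"
  proof -
    have "distinct (take i \<rho> @ v # drop (Suc i) \<rho>)" "set (take i \<rho> @ v # drop (Suc i) \<rho>) = {1..n + 1}"
      using \<rho> split by (auto simp: permutations_of_set_iff)
    then show ?thesis unfolding i by auto
  qed
  then have set: "set \<sigma> = {1..n + 1} - {v}" "distinct \<sigma>" by auto
  have "\<sigma> = map (bump v) \<pi>"
  proof (rule order_isomorphic_unique)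
    show "order_isomorphic \<sigma> (map (bump v) \<pi>)"
      using \<sigma>(2) order_isomorphic_map_bump order_isomorphic_sym order_isomorphic_trans by blast
    show "set \<sigma> = set (map (bump v) \<pi>)"
      using assms by (subst set_map_bump [OF _ v]) (simp_all add: set permutations_of_set_iff)
    show "distinct (map (bump v) \<pi>)"
      using assms by (auto simp: permutations_of_set_iff distinct_map inj_on_def)
  qed fact
  then have "ins \<pi> i v = take i \<sigma> @ v # drop i \<sigma>"
    by (simp add: ins_def)
  also have "\<dots> = \<rho>"
    using i len split by simp
  finally show "\<rho> \<in> (\<lambda>(i, v). ins \<pi> i v) ` ({..n} \<times> {1..n + 1})"
    using i v by (force simp: image_iff)
qed

lemma finite_covers [simp]: "finite (covers n \<pi>)"
  by (simp add: covers_def)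

lemma card_covers_le:
  assumes "\<pi> \<in> perms n"
  shows "card (covers n \<pi>) \<le> (n + 1)\<^sup>2"
proof -
  have "card (covers n \<pi>) \<le> card ({..n} \<times> {1..n + 1})"
    using covers_subset_ins [OF assms] by (intro surj_card_le) auto
  then show ?thesis by (simp add: power2_eq_square)
qed

text \<open>Inserting \<open>v\<close> just before an entry that becomes \<open>v + 1\<close> or \<open>v - 1\<close> gives the same
  permutation as inserting on the other side of that entry. Without those insertions
  there is no coincidence.\<close>

lemma card_covers_ge:
  assumes "\<pi> \<in> perms n"
  shows "n * (n - 1) \<le> card (covers n \<pi>)"
proof -
  \<comment> \<open>Position \<open>n\<close> is left out, as no entry follows it. At each other
    position two of the \<open>n + 1\<close> values are excluded, which leaves
    \<open>n - 1\<close>.\<close>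
  define I where "I = (SIGMA i:{..<n}. {1..n + 1} - {\<pi> ! i, Suc (\<pi> ! i)})"
  have len: "length \<pi> = n" using assms by (rule length_perms)
  have nth_ins: "ins \<pi> i v ! i = v"
    "i < j \<Longrightarrow> ins \<pi> j v ! i = bump v (\<pi> ! i)" if "i < n" "j < n" for i j v
    using that len by (auto simp: ins_def nth_append)
  \<comment> \<open>The two words are compared at the smaller position \<open>i\<close>: the first
    has \<open>v\<close> there, the second still has the bumped entry of \<open>\<pi>\<close>, which
    is one of the excluded values.\<close>
  have less: "ins \<pi> i v \<noteq> ins \<pi> j w" if "i < j" "(i, v) \<in> I" "(j, w) \<in> I" for i j v w
  proof
    assume "ins \<pi> i v = ins \<pi> j w"
    then have "v = bump w (\<pi> ! i)"
      using nth_ins(1) [of i i v] nth_ins(2) [of i j w] that by (auto simp: I_def)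
    then have "v = \<pi> ! i \<or> v = Suc (\<pi> ! i)" by (simp add: bump_def split: if_splits)
    then show False using that(2) by (auto simp: I_def)
  qed
  have "inj_on (\<lambda>(i, v). ins \<pi> i v) I"
  proof (rule inj_onI, clarify)
    fix i v j w assume *: "(i, v) \<in> I" "(j, w) \<in> I" "ins \<pi> i v = ins \<pi> j w"
    then have "i = j" using less by (metis linorder_neqE_nat)
    then show "i = j \<and> v = w" using * nth_ins(1) by (auto simp: I_def) metis
  qed
  moreover have "(\<lambda>(i, v). ins \<pi> i v) ` I \<subseteq> covers n \<pi>"
    using ins_in_perms [OF assms] perm_covers_ins by (auto simp: I_def covers_def)
  ultimately have "card I \<le> card (covers n \<pi>)"
    by (metis card_image card_mono finite_covers)
  moreover have "card I = n * (n - 1)"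
  proof -
    have "card ({1..n + 1} - {\<pi> ! i, Suc (\<pi> ! i)}) = n - 1" if "i < n" for i
    proof -
      have "\<pi> ! i \<in> {1..n}" using assms that len nth_mem by (fastforce simp: permutations_of_set_iff)
      then show ?thesis by (subst card_Diff_subset) auto
    qed
    then show ?thesis unfolding I_def by simp
  qed
  ultimately show ?thesis by simp
qed

text \<open>The deleted position determines the pattern, hence the covered permutation.\<close>

lemma card_covered_le:
  assumes "\<rho> \<in> perms (n + 1)"
  shows "card {\<pi> \<in> perms n. perm_covers \<rho> \<pi>} \<le> n + 1"
proof -
  \<comment> \<open>Standardisation of the word without its letter at \<open>i\<close>. Wherever it
    is evaluated below, the covered \<open>\<pi>\<close> itself is the witness for
    existence.\<close>
  let ?g = "\<lambda>i. THE \<pi>. \<pi> \<in> perms n \<and> order_isomorphic (take i \<rho> @ drop (Suc i) \<rho>) \<pi>"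
  have "{\<pi> \<in> perms n. perm_covers \<rho> \<pi>} \<subseteq> ?g ` {..n}"
  proof clarify
    fix \<pi> assume \<pi>: "\<pi> \<in> perms n" "perm_covers \<rho> \<pi>"
    then obtain \<sigma> where \<sigma>: "subseq \<sigma> \<rho>" "order_isomorphic \<sigma> \<pi>"
      by (auto simp: perm_covers_def)
    have len: "length \<rho> = n + 1" "length \<sigma> = n"
      using length_perms assms \<pi> \<sigma>(2) by (auto simp: order_isomorphic_def)
    obtain i where i: "i \<le> n" "\<sigma> = take i \<rho> @ drop (Suc i) \<rho>"
      using subseq_remove_nth [OF \<sigma>(1)] len by (metis Suc_eq_plus1 less_Suc_eq_le)
    have "\<pi>' = \<pi>" if "\<pi>' \<in> perms n" "order_isomorphic \<sigma> \<pi>'" for \<pi>'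
      using that \<pi>(1) \<sigma>(2)
      by (intro order_isomorphic_unique)
         (auto simp: permutations_of_set_iff intro: order_isomorphic_trans order_isomorphic_sym)
    then have "?g i = \<pi>"
      using \<pi>(1) \<sigma>(2) unfolding i(2) [symmetric] by (intro the_equality) blast+
    then show "\<pi> \<in> ?g ` {..n}" using i by blast
  qed
  then show ?thesis
    using surj_card_le [of "{..n}" "{\<pi> \<in> perms n. perm_covers \<rho> \<pi>}" ?g] by simp
qed

text \<open>Go up from \<open>\<pi>\<close> to a cover, then down to a permutation covered by it.
  This is the bound \<open>D\<close> for the disjoint subfamily.\<close>

lemma card_common_cover_le:
  assumes "\<pi> \<in> perms n"
  shows "card {\<tau> \<in> perms n. covers n \<pi> \<inter> covers n \<tau> \<noteq> {}} \<le> (n + 1) ^ 3"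
proof -
  have "card {\<tau> \<in> perms n. covers n \<pi> \<inter> covers n \<tau> \<noteq> {}} \<le>
      card (\<Union>\<rho>\<in>covers n \<pi>. {\<tau> \<in> perms n. perm_covers \<rho> \<tau>})"
    by (intro card_mono) (auto simp: covers_def)
  also have "\<dots> \<le> (\<Sum>\<rho>\<in>covers n \<pi>. card {\<tau> \<in> perms n. perm_covers \<rho> \<tau>})"
    by (rule card_UN_le) simp
  also have "\<dots> \<le> (\<Sum>\<rho>\<in>covers n \<pi>. n + 1)"
    by (intro sum_mono card_covered_le) (simp add: covers_def)
  also have "\<dots> = card (covers n \<pi>) * (n + 1)"
    by simp
  also have "\<dots> \<le> (n + 1)\<^sup>2 * (n + 1)"
    using card_covers_le [OF assms] by (rule mult_right_mono) simp
  finally show ?thesis by (simp only: power2_eq_square power3_eq_cube)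
qed

section \<open>Bounds for the cover probability at fixed \<open>n\<close>\<close>

lemma is_cover_iff:
  "A \<subseteq> perms (n + 1) \<Longrightarrow> is_cover n A \<longleftrightarrow> (\<forall>\<pi>\<in>perms n. A \<inter> covers n \<pi> \<noteq> {})"
  unfolding is_cover_def covers_def by blast

lemma cover_prob_eq:
  "cover_prob n p = measure_pmf.prob (random_subset (perms (n + 1)) p)
     {A. \<forall>\<pi>\<in>perms n. A \<inter> covers n \<pi> \<noteq> {}}"
  unfolding cover_prob_def
proof (rule measure_pmf.finite_measure_eq_AE)
  show "AE A in measure_pmf (random_subset (perms (n + 1)) p).
      A \<in> {A. is_cover n A} \<longleftrightarrow> A \<in> {A. \<forall>\<pi>\<in>perms n. A \<inter> covers n \<pi> \<noteq> {}}"
    unfolding AE_measure_pmf_iff mem_Collect_eq by (blast dest: set_random_subset is_cover_iff)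
qed simp_all

text \<open>Union bound over the \<open>n!\<close> permutations, with
  \<open>1 - p \<le> exp (- p)\<close>.\<close>

lemma cover_prob_ge:
  assumes "0 \<le> p" "p \<le> 1"
  shows "1 - fact n * exp (- p * real (n * (n - 1))) \<le> cover_prob n p"
proof -
  have "(1 - p) ^ card (covers n \<pi>) \<le> exp (- p * real (n * (n - 1)))" if "\<pi> \<in> perms n" for \<pi>
  proof -
    have "(1 - p) ^ card (covers n \<pi>) \<le> (1 - p) ^ (n * (n - 1))"
      using assms card_covers_ge [OF that] by (intro power_decreasing) auto
    also have "\<dots> \<le> exp (- p) ^ (n * (n - 1))"
      using assms exp_ge_add_one_self [of "- p"] by (intro power_mono) auto
    finally show ?thesis by (simp add: exp_of_nat_mult [symmetric] mult.commute)
  qed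
  then have "(\<Sum>\<pi>\<in>perms n. (1 - p) ^ card (covers n \<pi>)) \<le> fact n * exp (- p * real (n * (n - 1)))"
    using sum_bounded_above [of "perms n" "\<lambda>\<pi>. (1 - p) ^ card (covers n \<pi>)"] by simp
  then show ?thesis
    using prob_random_subset_hits_ge [of "perms n" "perms (n + 1)" p "covers n"] assms
    unfolding cover_prob_eq by (fastforce simp: covers_def)
qed

text \<open>Along a disjoint subfamily the probability is a product, and each factor is bounded by
  \<open>1 - x \<le> exp (- x)\<close>. The bound \<open>q\<close> on \<open>p\<close> makes the
  estimate depend on the threshold alone.\<close>

lemma cover_prob_le:
  assumes "0 \<le> p" "p \<le> q" "q \<le> 1" "n \<ge> 2"
  shows "cover_prob n p \<le> exp (- (fact n / real (n + 1) ^ 3 * (1 - q) ^ (n + 1)\<^sup>2))"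
proof -
  \<comment> \<open>For \<open>n \<ge> 2\<close> the lower bound \<open>n * (n - 1)\<close> is
    positive.\<close>
  have ne: "covers n \<pi> \<noteq> {}" if "\<pi> \<in> perms n" for \<pi>
    using card_covers_ge [OF that] assms(4) by auto
  obtain F where F: "F \<subseteq> perms n" "disjoint_family_on (covers n) F"
      and card: "card (perms n) \<le> card F * (n + 1) ^ 3"
    using large_disjoint_subfamily [of "perms n" "covers n" "(n + 1) ^ 3"]
      ne card_common_cover_le by auto
  have fin: "finite F" using F(1) by (rule finite_subset) simp
  have "cover_prob n p \<le> measure_pmf.prob (random_subset (perms (n + 1)) p)
      {A. \<forall>\<pi>\<in>F. A \<inter> covers n \<pi> \<noteq> {}}"
    unfolding cover_prob_eq using F by (intro measure_pmf.finite_measure_mono) auto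
  also have "\<dots> = (\<Prod>\<pi>\<in>F. 1 - (1 - p) ^ card (covers n \<pi>))"
    using F(1) assms by (intro prob_random_subset_hits F(2) fin) (auto simp: covers_def)
  also have "\<dots> \<le> (\<Prod>\<pi>\<in>F. exp (- ((1 - q) ^ (n + 1)\<^sup>2)))"
  proof (intro prod_mono conjI)
    fix \<pi> assume "\<pi> \<in> F"
    then have "(1 - q) ^ (n + 1)\<^sup>2 \<le> (1 - q) ^ card (covers n \<pi>)"
      using F assms card_covers_le by (intro power_decreasing) auto
    also have "\<dots> \<le> (1 - p) ^ card (covers n \<pi>)"
      using assms by (intro power_mono) auto
    finally show "1 - (1 - p) ^ card (covers n \<pi>) \<le> exp (- ((1 - q) ^ (n + 1)\<^sup>2))"
      using exp_ge_add_one_self [of "- ((1 - q) ^ (n + 1)\<^sup>2)"] by linarith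
    show "0 \<le> 1 - (1 - p) ^ card (covers n \<pi>)"
      using assms by (simp add: power_le_one)
  qed
  also have "\<dots> = exp (- (real (card F) * (1 - q) ^ (n + 1)\<^sup>2))"
    by (simp add: exp_of_nat_mult [symmetric])
  also have "\<dots> \<le> exp (- (fact n / real (n + 1) ^ 3 * (1 - q) ^ (n + 1)\<^sup>2))"
  proof -
    have "real (card (perms n)) \<le> real (card F * (n + 1) ^ 3)"
      using card by (rule of_nat_mono)
    then have "fact n / real (n + 1) ^ 3 \<le> real (card F)"
      by (simp add: divide_le_eq)
    then show ?thesis
      unfolding exp_le_cancel_iff neg_le_iff_le using assms by (intro mult_right_mono) auto
  qed
  finally show ?thesis .
qed

section \<open>Asymptotics at the two thresholds\<close>

text \<open>The left side is \<open>(n / e) ^ n\<close> for \<open>n > 0\<close>. The term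
  \<open>n ^ n / n!\<close> of the series for \<open>exp n\<close> is at most the whole sum.\<close>

lemma fact_ge_exp: "exp (real n * ln (real n) - real n) \<le> fact n"
proof (cases "n = 0")
  case False
  have "real n ^ n / fact n \<le> exp (real n)"
    using sum_le_suminf [OF summable_exp_generic [of "real n"], of "{n}"]
    by (simp add: exp_def divide_inverse mult.commute)
  then have "real n ^ n \<le> fact n * exp (real n)"
    by (simp add: divide_le_eq mult.commute)
  moreover have "real n ^ n = exp (real n * ln (real n))"
    using False by (simp add: exp_of_nat_mult)
  ultimately show ?thesis by (simp add: exp_diff divide_le_eq)
qed simp

theorem theorem6:
  shows "\<exists>(\<epsilon>s :: nat \<Rightarrow> real) (\<epsilon> :: nat \<Rightarrow> real).
    \<epsilon>s \<longlonglongrightarrow> 0 \<and> \<epsilon> \<longlonglongrightarrow> 0 \<and>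
    (\<forall>p :: nat \<Rightarrow> real. (\<forall>n. 0 \<le> p n \<and> p n \<le> 1) \<longrightarrow>
      ((\<forall>\<^sub>F n in sequentially. p n \<le> ln (real n) / real n * (1 + \<epsilon>s n)) \<longrightarrow>
         (\<lambda>n. cover_prob n (p n)) \<longlonglongrightarrow> 0) \<and>
      ((\<forall>\<^sub>F n in sequentially. p n \<ge> ln (real n) / real n * (1 + \<epsilon> n)) \<longrightarrow>
         (\<lambda>n. cover_prob n (p n)) \<longlonglongrightarrow> 1))"
proof -
  \<comment> \<open>These choices put the thresholds at \<open>(ln n - 2) / n\<close> and
    \<open>(ln n + 2) / n\<close>. In the first, a constant above 1 outweighs the loss of
    \<open>n\<close> in the exponent of \<open>(n / e) ^ n\<close>; in the second, any positive
    constant suffices.\<close>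
  have e1: "(\<lambda>n. - 2 / ln (real n)) \<longlonglongrightarrow> 0" by real_asymp
  have e2: "(\<lambda>n. 2 / ln (real n)) \<longlonglongrightarrow> 0" by real_asymp
  have "(\<lambda>n. cover_prob n (p n)) \<longlonglongrightarrow> 0"
    if p: "\<forall>n. 0 \<le> p n \<and> p n \<le> 1"
      and up: "\<forall>\<^sub>F n in sequentially. p n \<le> ln (real n) / real n * (1 + (- 2 / ln (real n)))" for p
  proof -
    define q where "q n = (ln (real n) - 2) / real n" for n
    \<comment> \<open>\<open>exp (L n)\<close> is the exponent from \<open>cover_prob_le\<close>
      with \<open>(n / e) ^ n\<close> in place of \<open>n!\<close>. As
      \<open>(n + 1)^2 * q n\<close> is about \<open>n * ln n - 2 * n\<close>, the terms
      \<open>n * ln n\<close> cancel and \<open>L n\<close> grows like \<open>n\<close>.\<close>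
    define L where "L n = real n * ln (real n) - real n - 3 * ln (real n + 1)
      + (real n + 1)\<^sup>2 * ln (1 - q n)" for n
    have le: "\<forall>\<^sub>F n in sequentially. cover_prob n (p n) \<le> exp (- exp (L n))"
    proof -
      have "\<forall>\<^sub>F n in sequentially. q n < 1" unfolding q_def by real_asymp
      then show ?thesis using up eventually_ge_at_top [of 2]
      proof eventually_elim
        case (elim n)
        have "exp (L n) = exp (real n * ln (real n) - real n) / exp (3 * ln (real n + 1))
            * exp ((real n + 1)\<^sup>2 * ln (1 - q n))"
          by (simp add: L_def exp_diff exp_add)
        also have "exp (3 * ln (real n + 1)) = real (n + 1) ^ 3"
          using exp_of_nat_mult [of 3 "ln (real n + 1)"] by (simp add: add.commute)
        also have "exp ((real n + 1)\<^sup>2 * ln (1 - q n)) = (1 - q n) ^ (n + 1)\<^sup>2"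
          using exp_of_nat_mult [of "(n + 1)\<^sup>2" "ln (1 - q n)"] elim(1)
          by (simp add: add.commute)
        also have "exp (real n * ln (real n) - real n) / real (n + 1) ^ 3 * (1 - q n) ^ (n + 1)\<^sup>2 \<le>
            fact n / real (n + 1) ^ 3 * (1 - q n) ^ (n + 1)\<^sup>2"
          using fact_ge_exp [of n] elim(1) by (intro mult_right_mono divide_right_mono) auto
        finally have *: "exp (L n) \<le> fact n / real (n + 1) ^ 3 * (1 - q n) ^ (n + 1)\<^sup>2" .
        \<comment> \<open>Here \<open>n \<ge> 2\<close> ensures \<open>ln n \<noteq> 0\<close>, so
          that the quotient cancels.\<close>
        have "ln (real n) / real n * (1 + (- 2 / ln (real n))) = q n"
          using elim(3) by (simp add: q_def field_simps)
        with cover_prob_le [of "p n" "q n" n] p elim * show ?case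
          by (smt (verit) exp_le_cancel_iff)
      qed
    qed
    have lim: "(\<lambda>n. exp (- exp (L n))) \<longlonglongrightarrow> 0"
      unfolding L_def q_def by real_asymp
    show ?thesis
      by (rule tendsto_sandwich [OF _ le tendsto_const lim]) (simp add: cover_prob_def)
  qed
  moreover have "(\<lambda>n. cover_prob n (p n)) \<longlonglongrightarrow> 1"
    if p: "\<forall>n. 0 \<le> p n \<and> p n \<le> 1"
      and lo: "\<forall>\<^sub>F n in sequentially. p n \<ge> ln (real n) / real n * (1 + 2 / ln (real n))" for p
  proof -
    \<comment> \<open>The logarithm of the failure bound after \<open>n! \<le> n ^ n\<close>; it
      equals \<open>ln n - 2 * n + 2\<close>.\<close>
    define U where "U n = real n * ln (real n) - (ln (real n) + 2) * (real n - 1)" for n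
    have le: "\<forall>\<^sub>F n in sequentially. 1 - exp (U n) \<le> cover_prob n (p n)"
      using lo eventually_ge_at_top [of 2]
    proof eventually_elim
      case (elim n)
      have "ln (real n) / real n * (1 + 2 / ln (real n)) = (ln (real n) + 2) / real n"
        using elim(2) by (simp add: field_simps)
      then have "(ln (real n) + 2) / real n * real (n * (n - 1)) \<le> p n * real (n * (n - 1))"
        using elim by (intro mult_right_mono) auto
      moreover have "(ln (real n) + 2) / real n * real (n * (n - 1)) = (ln (real n) + 2) * (real n - 1)"
        using elim by (simp add: of_nat_diff)
      ultimately have "exp (- p n * real (n * (n - 1))) \<le> exp (- ((ln (real n) + 2) * (real n - 1)))"
        by simp
      moreover have "fact n \<le> exp (real n * ln (real n))"
        using fact_le_power [of n, where 'a = real] elim by (simp add: exp_of_nat_mult)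
      ultimately have "fact n * exp (- p n * real (n * (n - 1))) \<le>
          exp (real n * ln (real n)) * exp (- ((ln (real n) + 2) * (real n - 1)))"
        by (intro mult_mono) auto
      also have "\<dots> = exp (U n)" by (simp add: U_def exp_add [symmetric])
      finally show ?case using cover_prob_ge [of "p n" n] p by fastforce
    qed
    have lim: "(\<lambda>n. 1 - exp (U n)) \<longlonglongrightarrow> 1"
      unfolding U_def by real_asymp
    show ?thesis
      by (rule tendsto_sandwich [OF le _ lim tendsto_const]) (simp add: cover_prob_def)
  qed
  ultimately show ?thesis using e1 e2 by blast
qed

end
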